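(* Let $n\ge 1$ be an odd integer and let $f:\{-1,+1\}^n\to\mathbb Z$ be a function. For $s\subseteq[n]$ put $j(s)=\sum_{x\in\{-1,+1\}^n} f(x)\prod_{i\in s}x_i$. If $j(s)=0$ for every $s\subseteq[n]$ with $|s|$ odd and $s\neq[n]$, then $2^{\,n-1}\mid j([n])$.
   Context: $[n]=\{1,2,\dots,n\}$. The integers $j(s)$ are called the (signed) $J$-characteristics of $f$. For integers $a,b$, $a\mid b$ means $b=ak$ for some integer $k$. The empty product is $1$. *)

theory Defs
  imports "HOL-Library.FuncSet"
begin

(* The points of {-1,+1}^n are the extensional functions on {1..n} (undefined outside {1..n}),
   so that each point has exactly one representative and the cube has 2^n elements. *)
definition sign_cube :: "nat \<Rightarrow> (nat \<Rightarrow> int) set" where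
  "sign_cube n = {1..n} \<rightarrow>\<^sub>E {-1, 1}"

(* Only the values of f on the cube matter. *)
definition J_char :: "nat \<Rightarrow> ((nat \<Rightarrow> int) \<Rightarrow> int) \<Rightarrow> nat set \<Rightarrow> int" where
  "J_char n f s = (\<Sum>x\<in>sign_cube n. f x * (\<Prod>i\<in>s. x i))"

end

theory Submission
  imports Defs
begin

text \<open>
  Summing the hypothesis over all odd \<open>s\<close> gives \<open>j([n]) = \<Sum>\<^sub>x f(x) S(x)\<close>, where \<open>S(x)\<close>
  is the sum of the odd-degree monomials of \<open>x\<close>. Since \<open>2 S(x) = \<Prod>(1 + x\<^sub>i) - \<Prod>(1 - x\<^sub>i)\<close> and
  every factor on the right is even, \<open>2\<^sup>n\<close> divides \<open>2 S(x)\<close>.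
\<close>

text \<open>Expand both products over the subsets of \<open>A\<close>. Replacing \<open>x\<close> by
  \<open>- x\<close> multiplies the monomial of \<open>s\<close> by (-1)^|s|, so in the difference
  the even monomials cancel and the odd ones double.\<close>

lemma sum_odd_subsets_prod:
  fixes x :: "'a \<Rightarrow> 'b::comm_ring_1"
  assumes "finite A"
  shows "2 * (\<Sum>s | s \<subseteq> A \<and> odd (card s). \<Prod>i\<in>s. x i) =
    (\<Prod>i\<in>A. 1 + x i) - (\<Prod>i\<in>A. 1 - x i)"
proof -
  have expand: "(\<Prod>i\<in>A. 1 + y i) = (\<Sum>s\<in>Pow A. \<Prod>i\<in>s. y i)" for y :: "'a \<Rightarrow> 'b"
    using prod_add[OF assms, of y "\<lambda>_. 1"] by (simp add: add.commute)
  have "(\<Prod>i\<in>A. 1 + x i) - (\<Prod>i\<in>A. 1 - x i) =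
      (\<Sum>s\<in>Pow A. (\<Prod>i\<in>s. x i) - (\<Prod>i\<in>s. - x i))"
    using expand[of x] expand[of "\<lambda>i. - x i"] by (simp add: sum_subtractf)
  also have "\<dots> = (\<Sum>s\<in>Pow A. if odd (card s) then 2 * (\<Prod>i\<in>s. x i) else 0)"
    by (intro sum.cong) (simp_all add: prod_uminus)
  also have "\<dots> = (\<Sum>s | s \<subseteq> A \<and> odd (card s). 2 * (\<Prod>i\<in>s. x i))"
    using assms by (simp add: sum.inter_filter[symmetric])
  finally show ?thesis
    by (simp add: sum_distrib_left)
qed

lemma power_dvd_prod:
  fixes g :: "'a \<Rightarrow> 'b::comm_semiring_1"
  assumes "\<And>i. i \<in> A \<Longrightarrow> c dvd g i"
  shows "c ^ card A dvd (\<Prod>i\<in>A. g i)"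
  using prod_dvd_prod[of A "\<lambda>_. c" g] assms by simp

lemma power_two_dvd_sum_odd_subsets_prod:
  fixes x :: "'a \<Rightarrow> int"
  assumes "finite A" and "A \<noteq> {}" and "\<And>i. i \<in> A \<Longrightarrow> odd (x i)"
  shows "2 ^ (card A - 1) dvd (\<Sum>s | s \<subseteq> A \<and> odd (card s). \<Prod>i\<in>s. x i)"
    (is "_ dvd ?S")
proof -
  have "2 ^ card A dvd 2 * ?S"
    unfolding sum_odd_subsets_prod[OF assms(1)]
    using assms(3) by (auto intro!: dvd_diff[OF power_dvd_prod power_dvd_prod])
  \<comment> \<open>As \<open>A\<close> is nonempty, \<open>card A - 1\<close> is a true
    predecessor, and one factor 2 cancels.\<close>
  moreover have "(2::int) ^ card A = 2 * 2 ^ (card A - 1)"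
    using assms(1,2) by (simp add: card_gt_0_iff flip: power_Suc)
  ultimately show ?thesis
    by simp
qed

theorem theorem3:
  fixes n :: nat and f :: "(nat \<Rightarrow> int) \<Rightarrow> int"
  assumes "n \<ge> 1" and "odd n"
    and "\<And>s. s \<subseteq> {1..n} \<Longrightarrow> odd (card s) \<Longrightarrow> s \<noteq> {1..n} \<Longrightarrow> J_char n f s = 0"
  shows "2 ^ (n - 1) dvd J_char n f {1..n}"
proof -
  let ?O = "{s. s \<subseteq> {1..n} \<and> odd (card s)}"
  have "J_char n f {1..n} = (\<Sum>s\<in>{{1..n}}. J_char n f s)"
    by simp
  \<comment> \<open>Oddness of \<open>n\<close> puts \<open>{1..n}\<close> itself into
    \<open>?O\<close>; every other member contributes 0 by hypothesis.\<close>
  also have "\<dots> = (\<Sum>s\<in>?O. J_char n f s)"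
    using assms(2,3) by (intro sum.mono_neutral_left) auto
  also have "\<dots> = (\<Sum>x\<in>sign_cube n. f x * (\<Sum>s\<in>?O. \<Prod>i\<in>s. x i))"
    unfolding J_char_def sum_distrib_left by (rule sum.swap)
  also have "2 ^ (n - 1) dvd \<dots>"
  \<comment> \<open>Divisibility holds for each point \<open>x\<close> separately, whatever the
    integer \<open>f x\<close> is.\<close>
  proof (rule dvd_sum, rule dvd_mult)
    fix x assume "x \<in> sign_cube n"
    then have "odd (x i)" if "i \<in> {1..n}" for i
      using PiE_mem[of x "{1..n}" "\<lambda>_. {-1, 1}" i] that by (auto simp: sign_cube_def)
    then show "2 ^ (n - 1) dvd (\<Sum>s\<in>?O. \<Prod>i\<in>s. x i)"
      using power_two_dvd_sum_odd_subsets_prod[of "{1..n}" x] assms(1) by simp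
  qed
  finally show ?thesis .
qed

end
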